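(* Let $s\ge 1$ be an integer, and for $k\ge 0$ let $S_k(s):=k\left(1+2^{k-1}+\cdots+s^{k-1}\right)$ (so $S_0(s)=0$). Then for all integers $m\geq 0$ we have $H_{2m}(S_k(s))=0$ and $$H_{2m+1}(S_k(s))=(-s^2)^{m+1}\prod_{\ell=1}^m\left(\frac{\ell^4(s^2-\ell^2)}{4(2\ell+1)(2\ell-1)}\right)^{2(m+1-\ell)},$$ and in particular, $H_{2m+1}(S_k(s))=0$ for $m\geq s$.
   Context: For a sequence $(c_0,c_1,\ldots)$ (indexed from $k=0$), $H_n(c_k)=\det\big(c_{i+j}\big)_{0\le i,j\le n}$; here the sequence is taken in the index $k$, with $s$ fixed. Empty products equal $1$. *)

theory Defs
  imports Complex_Main "Jordan_Normal_Form.Determinant"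
begin

text \<open>The index \<open>n\<close> is the largest row/column index, so the matrix has size \<open>n + 1\<close>.\<close>

definition hankel_det :: "nat \<Rightarrow> (nat \<Rightarrow> 'a :: comm_ring_1) \<Rightarrow> 'a" where
  "hankel_det n c = det (mat (n + 1) (n + 1) (\<lambda>(i, j). c (i + j)))"

text \<open>The exponent \<open>k - 1\<close> is an integer; for \<open>k = 0\<close> it is negative, but the bases are
  at least \<open>1\<close> and the leading factor \<open>k\<close> vanishes.\<close>

definition S :: "nat \<Rightarrow> nat \<Rightarrow> real" where
  "S s k = real k * (\<Sum>a = 1..s. real a powi (int k - 1))"

lemma S_0 [simp]: "S s 0 = 0"
  by (simp add: S_def)

end

theory Submission
  imports Defs "HOL-Computational_Algebra.Polynomial"
begin

text \<open>The sequence \<open>S\<^sub>k(s)\<close> consists of the moments of the functional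
  \<open>L(p) = p'(1) + \<dots> + p'(s)\<close>, so its Hankel determinants are Gram determinants of \<open>L\<close> in any two
  monic bases. The reflection \<open>y \<mapsto> s + 1 - y\<close> changes the sign of \<open>L\<close>, which makes the determinants
  of odd size vanish. With \<open>x = y - (s + 1)/2\<close> and the reflection invariant polynomials
  \<open>e\<^sub>k = \<Prod>\<^sub>r\<^sub><\<^sub>k (y - r - 1)(y - s + r)\<close>, \<open>f\<^sub>l = \<Prod>\<^sub>r\<^sub><\<^sub>l (y + r)(y - s - 1 - r)\<close>, the bases
  \<open>e\<^sub>0, x e\<^sub>0, e\<^sub>1, x e\<^sub>1, \<dots>\<close> and \<open>f\<^sub>0, x f\<^sub>0, f\<^sub>1, x f\<^sub>1, \<dots>\<close> have a Gram matrix that vanishes at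
  entries of equal parity and has the entries \<open>L(x e\<^sub>k f\<^sub>l)\<close> elsewhere; its determinant is, up to sign,
  the square of \<open>det L(x e\<^sub>k f\<^sub>l)\<close>. Finally \<open>L(x e\<^sub>k f\<^sub>l)\<close> equals \<open>1/(k + l + 1)\<close> times a
  factor depending on \<open>k\<close> and a factor depending on \<open>l\<close>, leaving a Hilbert determinant.\<close>

section \<open>Determinant identities\<close>

text \<open>In the Leibniz formula every permutation meets each row factor and each column factor
  exactly once, so both products leave the sum.\<close>

lemma det_scale_rows_cols:
  fixes a :: "nat \<Rightarrow> nat \<Rightarrow> 'a :: comm_ring_1"
  shows "det (mat n n (\<lambda>(i, j). u i * v j * a i j)) =
    (\<Prod>i<n. u i) * (\<Prod>j<n. v j) * det (mat n n (\<lambda>(i, j). a i j))"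
proof -
  have prod_v: "(\<Prod>i = 0..<n. v (p i)) = (\<Prod>j<n. v j)" if "p permutes {0..<n}" for p
    using prod.permute[OF that, of v] by (simp add: o_def lessThan_atLeast0)
  have "det (mat n n (\<lambda>(i, j). u i * v j * a i j)) =
    (\<Sum>p | p permutes {0..<n}. signof p * (\<Prod>i = 0..<n. u i * v (p i) * a i (p i)))"
    by (subst det_def'[of _ n]) (auto intro!: sum.cong prod.cong arg_cong2[of _ _ _ _ "(*)"])
  also have "\<dots> = (\<Sum>p | p permutes {0..<n}.
      (\<Prod>i<n. u i) * (\<Prod>j<n. v j) * (signof p * (\<Prod>i = 0..<n. a i (p i))))"
    by (rule sum.cong) (simp_all add: prod.distrib prod_v lessThan_atLeast0 mult_ac)
  also have "\<dots> = (\<Prod>i<n. u i) * (\<Prod>j<n. v j) * det (mat n n (\<lambda>(i, j). a i j))"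
    by (subst det_def'[of _ n])
      (auto simp: sum_distrib_left intro!: sum.cong prod.cong arg_cong2[of _ _ _ _ "(*)"])
  finally show ?thesis .
qed

text \<open>Block elimination with the last diagonal entry as pivot: the matrix is
  \<open>T * U\<close>, with \<open>T\<close> unit upper triangular and \<open>U\<close> block lower
  triangular, its diagonal blocks being the Schur complement and the pivot.\<close>

lemma det_Schur_last:
  fixes a :: "nat \<Rightarrow> nat \<Rightarrow> 'a :: field"
  assumes "a n n \<noteq> 0"
  shows "det (mat (Suc n) (Suc n) (\<lambda>(i, j). a i j)) =
    a n n * det (mat n n (\<lambda>(i, j). a i j - a i n * a n j / a n n))"
proof -
  define T where "T = mat (Suc n) (Suc n)
    (\<lambda>(i, j). if i = j then 1 else if j = n then a i n / a n n else 0)"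
  define U where "U = four_block_mat (mat n n (\<lambda>(i, j). a i j - a i n * a n j / a n n))
    (0\<^sub>m n 1) (mat 1 n (\<lambda>(i, j). a n j)) (mat 1 1 (\<lambda>(i, j). a n n))"
  have T: "T \<in> carrier_mat (Suc n) (Suc n)" and U: "U \<in> carrier_mat (Suc n) (Suc n)"
    unfolding T_def U_def by auto
  \<comment> \<open>One formula covers the last column too: for \<open>j = n\<close> the Schur entry
    is 0, which matches the zero block.\<close>
  have U_entry: "U $$ (i, j) = (if i < n then a i j - a i n * a n j / a n n else a n j)"
    if "i < Suc n" "j < Suc n" for i j
    using that assms unfolding U_def by (auto simp: less_Suc_eq)
  have "mat (Suc n) (Suc n) (\<lambda>(i, j). a i j) = T * U"
  proof (rule eq_matI)
    fix i j assume ij: "i < dim_row (T * U)" "j < dim_col (T * U)"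
    then have i: "i < Suc n" and j: "j < Suc n" using T U by auto
    have "(T * U) $$ (i, j) = (\<Sum>k = 0..<Suc n. T $$ (i, k) * U $$ (k, j))"
      using i j T U by (simp add: scalar_prod_def)
    also have "\<dots> = (\<Sum>k = 0..<n. T $$ (i, k) * U $$ (k, j)) + T $$ (i, n) * U $$ (n, j)"
      by simp
    also have "(\<Sum>k = 0..<n. T $$ (i, k) * U $$ (k, j)) =
        (\<Sum>k = 0..<n. if k = i then U $$ (k, j) else 0)"
      using i by (intro sum.cong) (auto simp: T_def)
    also have "\<dots> + T $$ (i, n) * U $$ (n, j) = a i j"
      using i j assms by (auto simp: U_entry T_def less_Suc_eq)
    finally show "mat (Suc n) (Suc n) (\<lambda>(i, j). a i j) $$ (i, j) = (T * U) $$ (i, j)"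
      using i j by simp
  qed (use T U in auto)
  moreover have "det T = 1"
    by (subst det_upper_triangular[OF _ T])
      (auto simp: T_def upper_triangular_def prod_list_diag_prod)
  moreover have "det U = det (mat n n (\<lambda>(i, j). a i j - a i n * a n j / a n n)) * a n n"
    unfolding U_def by (subst det_four_block_mat_upper_right_zero_col)
      (auto simp: det_single intro!: arg_cong2[of _ _ _ _ "(*)"])
  ultimately show ?thesis
    using det_mult[OF T U] by simp
qed

text \<open>The Schur complement of the last entry of a Hilbert matrix is the smaller Hilbert matrix
  with row i scaled by \<open>u i\<close> and column j by \<open>u j\<close>, because (i+n+1)(n+j+1)
  - (2n+1)(i+j+1) = (n-i)(n-j).\<close>

lemma det_Hilbert:
  "det (mat n n (\<lambda>(i, j). 1 / (real i + real j + 1))) =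
    (\<Prod>l<n. fact l ^ 4 / (fact (2 * l) * fact (2 * l + 1)))"
proof (induction n)
  case (Suc n)
  define u where "u i = (real n - real i) / (real n + real i + 1)" for i
  have prod_u: "(\<Prod>i<n. u i) = fact n ^ 2 / fact (2 * n)"
  proof -
    have num: "(\<Prod>i<n. real n - real i) = fact n"
    proof -
      have "(\<Prod>i<n. real n - real i) = (\<Prod>i<n. real (n - i))"
        by (intro prod.cong) (auto simp: of_nat_diff)
      also have "\<dots> = (\<Prod>i<n. real (Suc i))"
        using prod.nat_diff_reindex[of "\<lambda>i. real (Suc i)" n]
        by (simp add: Suc_diff_Suc)
      finally show ?thesis by (simp add: fact_prod_Suc lessThan_atLeast0)
    qed
    \<comment> \<open>The number of factors is decoupled from n, since n also occurs inside each
      factor and must stay fixed in the induction.\<close>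
    have "(\<Prod>i<m. real n + real i + 1) * fact n = fact (n + m)" for m
    proof (induction m)
      case (Suc m)
      have "(\<Prod>i<Suc m. real n + real i + 1) * fact n =
          ((\<Prod>i<m. real n + real i + 1) * fact n) * (real n + real m + 1)"
        by simp
      then show ?case unfolding Suc by (simp add: algebra_simps)
    qed simp
    then have "(\<Prod>i<n. real n + real i + 1) = fact (2 * n) / fact n"
      by (simp add: eq_divide_eq mult_2)
    with num show ?thesis
      by (simp add: u_def prod_dividef power2_eq_square)
  qed
  have schur: "1 / (real i + real j + 1)
      - 1 / (real i + real n + 1) * (1 / (real n + real j + 1)) / (1 / (real n + real n + 1)) =
    u i * u j * (1 / (real i + real j + 1))" for i j
  proof -
    have nz: "real i + real j + 1 \<noteq> 0" "real i + real n + 1 \<noteq> 0" "real n + real j + 1 \<noteq> 0"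
      "real n + real n + 1 \<noteq> 0" "real n + real i + 1 \<noteq> 0"
      by linarith+
    then show ?thesis
      unfolding u_def by (simp add: divide_simps) (simp add: algebra_simps)
  qed
  have "det (mat (Suc n) (Suc n) (\<lambda>(i, j). 1 / (real i + real j + 1))) =
    1 / (2 * real n + 1) * det (mat n n (\<lambda>(i, j). u i * u j * (1 / (real i + real j + 1))))"
    by (subst det_Schur_last[where a = "\<lambda>i j. 1 / (real i + real j + 1)"]) (simp_all only: schur, simp_all)
  also have "det (mat n n (\<lambda>(i, j). u i * u j * (1 / (real i + real j + 1)))) =
    (fact n ^ 2 / fact (2 * n)) ^ 2 * (\<Prod>l<n. fact l ^ 4 / (fact (2 * l) * fact (2 * l + 1)))"
    by (subst det_scale_rows_cols) (simp add: Suc.IH prod_u power2_eq_square)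
  finally show ?case
    by (simp add: field_simps power2_eq_square eval_nat_numeral)
qed simp

section \<open>Determinants with zeros in a checkerboard pattern\<close>

definition block_perm :: "nat \<Rightarrow> nat \<Rightarrow> nat" where
  "block_perm n i = (if i < n then 2 * i else if i < 2 * n then 2 * (i - n) + 1 else i)"

lemma block_perm_permutes: "block_perm n permutes {0..<2 * n}"
proof (rule bij_imp_permutes)
  have "inj_on (block_perm n) {0..<2 * n}"
    by (rule inj_onI) (auto simp: block_perm_def split: if_splits; presburger)
  moreover have "block_perm n ` {0..<2 * n} \<subseteq> {0..<2 * n}"
    by (auto simp: block_perm_def)
  ultimately show "bij_betw (block_perm n) {0..<2 * n} {0..<2 * n}"
    by (simp add: bij_betw_def endo_inj_surj)
qed (simp add: block_perm_def)

text \<open>The sign of the permutation enters once through the rows and once, after transposing,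
  through the columns; its square is 1.\<close>

lemma det_permute_rows_cols:
  fixes a :: "nat \<Rightarrow> nat \<Rightarrow> 'a :: comm_ring_1"
  assumes p: "p permutes {0..<n}"
  shows "det (mat n n (\<lambda>(i, j). a (p i) (p j))) = det (mat n n (\<lambda>(i, j). a i j))"
proof -
  have lt: "p i < n" if "i < n" for i
    using permutes_in_image[OF p, of i] that by simp
  have rows: "det (mat n n (\<lambda>(i, j). b (p i) j)) = signof p * det (mat n n (\<lambda>(i, j). b i j))"
    for b :: "nat \<Rightarrow> nat \<Rightarrow> 'a"
  proof -
    have "mat n n (\<lambda>(i, j). b (p i) j) = mat n n (\<lambda>(i, j). mat n n (\<lambda>(i, j). b i j) $$ (p i, j))"
      by (rule eq_matI) (auto simp: lt)
    then show ?thesis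
      using det_permute_rows[OF _ p, of "mat n n (\<lambda>(i, j). b i j)"] by simp
  qed
  have tr: "det (mat n n (\<lambda>(i, j). b j i)) = det (mat n n (\<lambda>(i, j). b i j))"
    for b :: "nat \<Rightarrow> nat \<Rightarrow> 'a"
  proof -
    have "mat n n (\<lambda>(i, j). b j i) = transpose_mat (mat n n (\<lambda>(i, j). b i j))"
      by (rule eq_matI) auto
    then show ?thesis by (simp add: det_transpose[of _ n])
  qed
  have "det (mat n n (\<lambda>(i, j). a (p i) (p j))) = signof p * det (mat n n (\<lambda>(i, j). a i (p j)))"
    by (rule rows)
  also have "\<dots> = signof p * det (mat n n (\<lambda>(i, j). a j (p i)))"
    by (subst tr) simp
  also have "\<dots> = (signof p * signof p) * det (mat n n (\<lambda>(i, j). a j i))"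
    by (subst rows[of "\<lambda>i j. a j i"]) simp
  also have "\<dots> = det (mat n n (\<lambda>(i, j). a i j))"
    by (subst tr) (simp add: sign_def)
  finally show ?thesis .
qed

text \<open>Listing the even indices before the odd ones leaves zero diagonal blocks and two equal
  off-diagonal blocks \<open>G\<close>. The zero block commutes with \<open>G\<close>, so the
  determinant is that of \<open>- G * G\<close>.\<close>

lemma det_checkerboard:
  fixes g :: "nat \<Rightarrow> nat \<Rightarrow> 'a :: idom"
  shows "det (mat (2 * n) (2 * n)
      (\<lambda>(i, j). if even (i + j) then 0 else g (i div 2) (j div 2))) =
    (- 1) ^ n * det (mat n n (\<lambda>(i, j). g i j)) ^ 2"
proof -
  define G where "G = mat n n (\<lambda>(i, j). g i j)"
  have G: "G \<in> carrier_mat n n" by (simp add: G_def)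
  have "det (mat (2 * n) (2 * n) (\<lambda>(i, j). if even (i + j) then 0 else g (i div 2) (j div 2))) =
    det (mat (2 * n) (2 * n) (\<lambda>(i, j). if even (block_perm n i + block_perm n j) then 0
      else g (block_perm n i div 2) (block_perm n j div 2)))"
    by (rule det_permute_rows_cols[OF block_perm_permutes, symmetric])
  also have "mat (2 * n) (2 * n) (\<lambda>(i, j). if even (block_perm n i + block_perm n j) then 0
      else g (block_perm n i div 2) (block_perm n j div 2)) =
    four_block_mat (0\<^sub>m n n) G G (0\<^sub>m n n)"
    by (rule eq_matI) (auto simp: block_perm_def G_def)
  also have "det \<dots> = det (0\<^sub>m n n * 0\<^sub>m n n - G * G)"
    using G by (intro det_four_block_mat) auto
  also have "0\<^sub>m n n * 0\<^sub>m n n - G * G = (- 1) \<cdot>\<^sub>m (G * G)"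
    by (rule eq_matI) (use G in auto)
  also have "det \<dots> = (- 1) ^ n * det G ^ 2"
    using G by (simp add: det_mult power2_eq_square)
  finally show ?thesis by (simp add: G_def)
qed

text \<open>The Gram matrix factors as \<open>P p * H * transpose_mat (P q)\<close> with coefficient
  matrices that the degree bounds make lower triangular. Monic bases thus give the Hankel
  determinant itself.\<close>

lemma hankel_det_change_basis:
  fixes L :: "'a :: comm_ring_1 poly \<Rightarrow> 'a"
  assumes add: "\<And>p q. L (p + q) = L p + L q"
    and smult: "\<And>a p. L (smult a p) = a * L p"
    and deg: "\<And>i. degree (p i) \<le> i" "\<And>i. degree (q i) \<le> i"
  shows "det (mat (Suc n) (Suc n) (\<lambda>(i, j). L (p i * q j))) =
    (\<Prod>i\<le>n. coeff (p i) i) * (\<Prod>i\<le>n. coeff (q i) i) * hankel_det n (\<lambda>k. L (monom 1 k))"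
proof -
  define P where "P r = mat (Suc n) (Suc n) (\<lambda>(i, k). coeff (r i) k)" for r :: "nat \<Rightarrow> 'a poly"
  define H where "H = mat (Suc n) (Suc n) (\<lambda>(i, j). L (monom 1 (i + j)))"
  have car: "P r \<in> carrier_mat (Suc n) (Suc n)" "H \<in> carrier_mat (Suc n) (Suc n)" for r
    by (simp_all add: P_def H_def)
  have L0: "L 0 = 0" using smult[of 0 0] by simp
  have L_sum: "L (sum f A) = (\<Sum>x\<in>A. L (f x))" for f :: "nat \<Rightarrow> 'a poly" and A
    by (induction A rule: infinite_finite_induct) (simp_all add: add L0)
  have expand: "r = (\<Sum>k = 0..<Suc n. smult (coeff r k) (monom 1 k))" if "degree r \<le> n" for r :: "'a poly"
    using poly_as_sum_of_monoms'[OF that]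
    by (simp add: smult_monom lessThan_Suc_atMost lessThan_atLeast0[symmetric] del: sum.lessThan_Suc)
  have det_P: "det (P r) = (\<Prod>i\<le>n. coeff (r i) i)" if "\<And>i. degree (r i) \<le> i" for r
  proof -
    have "coeff (r i) j = 0" if "i < j" for i j
      using that \<open>degree (r i) \<le> i\<close> by (intro coeff_eq_0) simp
    then have "det (P r) = (\<Prod>i = 0..<Suc n. coeff (r i) i)"
      by (subst det_lower_triangular[OF _ car(1)]) (auto simp: P_def prod_list_diag_prod)
    then show ?thesis
      by (simp add: lessThan_Suc_atMost lessThan_atLeast0[symmetric] del: prod.op_ivl_Suc)
  qed
  have "mat (Suc n) (Suc n) (\<lambda>(i, j). L (p i * q j)) = P p * H * transpose_mat (P q)"
  proof (rule eq_matI)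
    fix i j assume "i < dim_row (P p * H * transpose_mat (P q))"
      "j < dim_col (P p * H * transpose_mat (P q))"
    then have i: "i < Suc n" and j: "j < Suc n" by (simp_all add: P_def)
    have "p i = (\<Sum>k = 0..<Suc n. smult (coeff (p i) k) (monom 1 k))"
      using deg(1)[of i] i by (intro expand) simp
    moreover have "q j = (\<Sum>k = 0..<Suc n. smult (coeff (q j) k) (monom 1 k))"
      using deg(2)[of j] j by (intro expand) simp
    ultimately have "p i * q j = (\<Sum>k = 0..<Suc n. smult (coeff (p i) k) (monom 1 k)) *
        (\<Sum>l = 0..<Suc n. smult (coeff (q j) l) (monom 1 l))"
      by (rule arg_cong2)
    also have "\<dots> = (\<Sum>k = 0..<Suc n. \<Sum>l = 0..<Suc n.
        smult (coeff (p i) k * coeff (q j) l) (monom 1 (k + l)))"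
      unfolding sum_product by (intro sum.cong refl) (simp add: mult_monom mult_ac)
    \<comment> \<open>The order of summation is adapted to the bracketing of the triple matrix
      product, whose outer sum runs over l.\<close>
    also have "\<dots> = (\<Sum>l = 0..<Suc n. \<Sum>k = 0..<Suc n.
        smult (coeff (p i) k * coeff (q j) l) (monom 1 (k + l)))"
      by (rule sum.swap)
    finally have "p i * q j = (\<Sum>l = 0..<Suc n. \<Sum>k = 0..<Suc n.
        smult (coeff (p i) k * coeff (q j) l) (monom 1 (k + l)))" .
    then have "L (p i * q j) = (\<Sum>l = 0..<Suc n. \<Sum>k = 0..<Suc n.
        coeff (p i) k * coeff (q j) l * L (monom 1 (k + l)))"
      by (simp only: L_sum smult)
    also have "\<dots> = (P p * H * transpose_mat (P q)) $$ (i, j)"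
      using i j by (simp add: P_def H_def scalar_prod_def sum_distrib_left sum_distrib_right mult_ac del: sum.op_ivl_Suc)
    finally show "mat (Suc n) (Suc n) (\<lambda>(i, j). L (p i * q j)) $$ (i, j) =
        (P p * H * transpose_mat (P q)) $$ (i, j)"
      using i j by simp
  qed (simp_all add: P_def)
  then have "det (mat (Suc n) (Suc n) (\<lambda>(i, j). L (p i * q j))) = det (P p) * det H * det (P q)"
    using det_mult[OF mult_carrier_mat[OF car(1) car(2)] transpose_carrier_mat[THEN iffD2, OF car(1)]]
      det_mult[OF car(1) car(2)] det_transpose[OF car(1)]
    by simp
  moreover have "det H = hankel_det n (\<lambda>k. L (monom 1 k))"
    by (simp add: H_def hankel_det_def)
  ultimately show ?thesis
    by (simp add: det_P deg mult_ac)
qed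



section \<open>Two interpolation bases\<close>

definition deriv_sum :: "nat \<Rightarrow> real poly \<Rightarrow> real" where
  "deriv_sum s p = (\<Sum>j = 1..s. poly (pderiv p) (real j))"

lemma deriv_sum_add: "deriv_sum s (p + q) = deriv_sum s p + deriv_sum s q"
  by (simp add: deriv_sum_def pderiv_add sum.distrib)

lemma deriv_sum_smult: "deriv_sum s (smult a p) = a * deriv_sum s p"
  by (simp add: deriv_sum_def pderiv_smult sum_distrib_left)

lemma deriv_sum_monom: "deriv_sum s (monom 1 k) = S s k"
\<comment> \<open>For k = 0 both sides vanish; otherwise the integer exponent is a natural number
  and \<open>powi\<close> is an ordinary power.\<close>
proof (cases k)
  case (Suc n)
  then have "int k - 1 = int n" "k - 1 = n" by simp_all
  then show ?thesis
    by (simp only: deriv_sum_def S_def pderiv_monom poly_monom sum_distrib_left power_int_of_nat mult_1_right)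
qed (simp add: deriv_sum_def monom_0)

text \<open>The reflection permutes the points 1, ..., s, and the chain rule contributes the
  sign.\<close>

lemma deriv_sum_reflect: "deriv_sum s (p \<circ>\<^sub>p [:real s + 1, - 1:]) = - deriv_sum s p"
proof -
  have "deriv_sum s (p \<circ>\<^sub>p [:real s + 1, - 1:]) =
      (\<Sum>j = 1..s. - poly (pderiv p) (real (s + 1 - j)))"
    unfolding deriv_sum_def
    by (intro sum.cong) (auto simp: pderiv_pcompose poly_pcompose pderiv_pCons add.commute)
  also have "\<dots> = (\<Sum>j = 1..s. - poly (pderiv p) (real j))"
    by (rule sum.reindex_bij_witness[of _ "\<lambda>j. s + 1 - j" "\<lambda>j. s + 1 - j"]) auto
  finally show ?thesis
    by (simp add: deriv_sum_def sum_negf)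
qed

lemma deriv_sum_telescope:
  "deriv_sum s p - deriv_sum s (p \<circ>\<^sub>p [:- 1, 1:]) =
    poly (pderiv p) (real s) - poly (pderiv p) 0"
  by (induction s) (simp_all add: deriv_sum_def pderiv_pcompose poly_pcompose pderiv_pCons)

lemma poly_pderiv_root: "poly (pderiv ([:- a, 1:] * p)) a = poly p (a :: real)"
  by (simp only: pderiv_mult) (simp add: pderiv_pCons)

text \<open>The roots are 1, ..., k and s-k+1, ..., s, paired symmetrically about (s+1)/2 from the
  ends of the summation range inwards.\<close>

definition lower_basis :: "nat \<Rightarrow> nat \<Rightarrow> real poly" where
  "lower_basis s k = (\<Prod>r<k. [:- (real r + 1), 1:] * [:- (real s - real r), 1:])"

text \<open>The roots 1-l, ..., 0 and s+1, ..., s+l proceed outwards. Together with those of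
  \<open>lower_basis s k\<close> they form two runs of consecutive integers, so a unit shift alters
  only the ends of the runs.\<close>

definition upper_basis :: "nat \<Rightarrow> nat \<Rightarrow> real poly" where
  "upper_basis s l = (\<Prod>r<l. [:real r, 1:] * [:- (real s + 1 + real r), 1:])"

definition centre :: "nat \<Rightarrow> real poly" where
  "centre s = [:- (real s + 1) / 2, 1:]"

section \<open>Values, degrees and reflection symmetry of the bases\<close>

lemma poly_lower_basis: "poly (lower_basis s k) y = (\<Prod>r<k. (y - real r - 1) * (y - real s + real r))"
  by (simp add: lower_basis_def poly_prod algebra_simps)

lemma poly_upper_basis: "poly (upper_basis s l) y = (\<Prod>r<l. (y + real r) * (y - real s - 1 - real r))"
  by (simp add: upper_basis_def poly_prod algebra_simps)

lemma monic_lower_basis: "degree (lower_basis s k) = 2 * k" "lead_coeff (lower_basis s k) = 1"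
proof -
  show "lead_coeff (lower_basis s k) = 1"
    by (simp add: lower_basis_def lead_coeff_prod lead_coeff_mult del: mult_pCons_left)
  show "degree (lower_basis s k) = 2 * k"
    by (simp add: lower_basis_def degree_prod_eq_sum_degree degree_mult_eq del: mult_pCons_left)
qed

lemma monic_upper_basis: "degree (upper_basis s k) = 2 * k" "lead_coeff (upper_basis s k) = 1"
proof -
  show "lead_coeff (upper_basis s k) = 1"
    by (simp add: upper_basis_def lead_coeff_prod lead_coeff_mult del: mult_pCons_left)
  show "degree (upper_basis s k) = 2 * k"
    by (simp add: upper_basis_def degree_prod_eq_sum_degree degree_mult_eq del: mult_pCons_left)
qed

lemma reflect_lower_basis: "lower_basis s k \<circ>\<^sub>p [:real s + 1, - 1:] = lower_basis s k"
  unfolding lower_basis_def pcompose_prod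
  by (intro prod.cong refl) (simp add: pcompose_mult pcompose_pCons algebra_simps)

lemma reflect_upper_basis: "upper_basis s k \<circ>\<^sub>p [:real s + 1, - 1:] = upper_basis s k"
  unfolding upper_basis_def pcompose_prod
  by (intro prod.cong refl) (simp add: pcompose_mult pcompose_pCons algebra_simps)

lemma reflect_centre: "centre s \<circ>\<^sub>p [:real s + 1, - 1:] = - centre s"
  by (simp add: centre_def pcompose_pCons field_simps)

text \<open>A unit shift moves both runs of roots by one, so all but their end factors cancel.
  Stated without division, the relation also holds at the roots.\<close>

lemma shift_lower_basis:
  "poly (lower_basis s k) (y - 1) * ((y - 1) * (y - real s - 1 + real k)) =
    poly (lower_basis s k) y * ((y - real k - 1) * (y - real s - 1))"
proof (induction k)
  case (Suc k)
  have lin: "y - 1 - real k - 1 = y - real (Suc k) - 1" "y - 1 - real s + real k = y - real s - 1 + real k"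
    "y - real s - 1 + real (Suc k) = y - real s + real k"
    by simp_all
  have "poly (lower_basis s (Suc k)) (y - 1) * ((y - 1) * (y - real s - 1 + real (Suc k))) =
      (poly (lower_basis s k) (y - 1) * ((y - 1) * (y - real s - 1 + real k))) *
      ((y - real (Suc k) - 1) * (y - real s + real k))"
    by (simp only: poly_lower_basis prod.lessThan_Suc lin mult_ac)
  also have "\<dots> = poly (lower_basis s (Suc k)) y *
      ((y - real (Suc k) - 1) * (y - real s - 1))"
    unfolding Suc by (simp only: poly_lower_basis prod.lessThan_Suc mult_ac)
  finally show ?case .
qed (simp add: poly_lower_basis)

text \<open>The same cancellation; the factors y - 1 and y - s - 1 have changed sides compared with
  \<open>shift_lower_basis\<close>, so they drop out of the product of the two relations.\<close>

lemma shift_upper_basis: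
  "poly (upper_basis s l) (y - 1) * ((y + real l - 1) * (y - real s - 1)) =
    poly (upper_basis s l) y * ((y - 1) * (y - real s - 1 - real l))"
proof (induction l)
  case (Suc l)
  have lin: "y - 1 + real l = y + real l - 1" "y - 1 - real s - 1 - real l = y - real s - 1 - real (Suc l)"
    "y + real (Suc l) - 1 = y + real l"
    by simp_all
  have "poly (upper_basis s (Suc l)) (y - 1) * ((y + real (Suc l) - 1) * (y - real s - 1)) =
      (poly (upper_basis s l) (y - 1) * ((y + real l - 1) * (y - real s - 1))) *
      ((y + real l) * (y - real s - 1 - real (Suc l)))"
    by (simp only: poly_upper_basis prod.lessThan_Suc lin mult_ac)
  also have "\<dots> = poly (upper_basis s (Suc l)) y *
      ((y - 1) * (y - real s - 1 - real (Suc l)))"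
    unfolding Suc by (simp only: poly_upper_basis prod.lessThan_Suc mult_ac)
  finally show ?case .
qed (simp add: poly_upper_basis)

text \<open>The product of two basis polynomials with \<^term>\<open>centre s\<close> is, up to a constant, a
  backward difference, so that the sum of its derivatives telescopes.\<close>

lemma deriv_sum_lower_upper:
  "deriv_sum s (centre s * lower_basis s k * upper_basis s l) =
    (fact k * (\<Prod>r\<le>k. real s - real r)) *
    ((- 1) ^ l * fact l * (\<Prod>r<l. real s + 1 + real r)) *
    (1 / (real k + real l + 1))"
proof -
  \<comment> \<open>\<open>V\<close> extends both runs of roots by one integer to the left, to -l,
    ..., k and s-k, ..., s+l. After the shift they are extended to the right instead, which is
    \<open>?W\<close>.\<close>
  define V where
    "V = lower_basis s k * upper_basis s l * ([:real l, 1:] * [:- (real s - real k), 1:])"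
  let ?W = "lower_basis s k * upper_basis s l *
      ([:- (real k + 1), 1:] * [:- (real s + 1 + real l), 1:])"
  let ?z = "[:- 1, 1:] * [:- (real s + 1), 1:] :: real poly"
  have lin: "poly [:c, 1:] y = y + c" for c y :: real
    by simp
  have "(V \<circ>\<^sub>p [:- 1, 1:]) * ?z = ?W * ?z"
  proof (rule poly_ext)
    fix y
    let ?e = "poly (lower_basis s k)" and ?f = "poly (upper_basis s l)"
    have arg: "y + - 1 = y - 1" "y - 1 + real l = y + real l - 1"
      "y - 1 + - (real s - real k) = y - real s - 1 + real k"
      "y + - (real s + 1) = y - real s - 1" "y + - (real k + 1) = y - real k - 1"
      "y + - (real s + 1 + real l) = y - real s - 1 - real l"
      by simp_all
    have "poly ((V \<circ>\<^sub>p [:- 1, 1:]) * ?z) y =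
        (?e (y - 1) * ((y - 1) * (y - real s - 1 + real k))) *
        (?f (y - 1) * ((y + real l - 1) * (y - real s - 1)))"
      by (simp only: V_def poly_pcompose poly_mult lin arg mult_ac)
    also have "\<dots> = poly (?W * ?z) y"
      unfolding shift_lower_basis shift_upper_basis by (simp only: poly_mult lin arg mult_ac)
    finally show "poly ((V \<circ>\<^sub>p [:- 1, 1:]) * ?z) y = poly (?W * ?z) y" .
  qed
  then have shift: "V \<circ>\<^sub>p [:- 1, 1:] = ?W"
    by (subst (asm) mult_right_cancel) auto
  \<comment> \<open>The quadratic terms cancel and the linear remainder vanishes at the centre of
    symmetry; this is the origin of the Hilbert entry 1/(k+l+1).\<close>
  have "[:real l, 1:] * [:- (real s - real k), 1:] -
      [:- (real k + 1), 1:] * [:- (real s + 1 + real l), 1:] =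
      smult (2 * (real k + real l + 1)) (centre s)"
    by (simp add: centre_def field_simps)
  then have "V - V \<circ>\<^sub>p [:- 1, 1:] =
      smult (2 * (real k + real l + 1)) (centre s * lower_basis s k * upper_basis s l)"
    unfolding shift unfolding V_def right_diff_distrib[symmetric]
    by (simp only: mult_smult_right mult_ac)
  then have "V = V \<circ>\<^sub>p [:- 1, 1:] +
      smult (2 * (real k + real l + 1)) (centre s * lower_basis s k * upper_basis s l)"
    by (simp add: algebra_simps)
  then have "deriv_sum s V = deriv_sum s (V \<circ>\<^sub>p [:- 1, 1:]) +
      2 * (real k + real l + 1) * deriv_sum s (centre s * lower_basis s k * upper_basis s l)"
    by (metis deriv_sum_add deriv_sum_smult)
  then have main: "2 * (real k + real l + 1) *
      deriv_sum s (centre s * lower_basis s k * upper_basis s l) =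
      poly (pderiv V) (real s) - poly (pderiv V) 0"
    using deriv_sum_telescope[of s V] by simp
  let ?c = "(fact k * (\<Prod>r\<le>k. real s - real r)) *
    ((- 1) ^ l * fact l * (\<Prod>r<l. real s + 1 + real r))"
  have fact: "(\<Prod>r<n. real r + 1) = fact n" for n
    by (induction n) (simp_all add: algebra_simps)
  have neg: "(\<Prod>r<l. - g r) = (- 1) ^ l * (\<Prod>r<l. g r)" for g :: "nat \<Rightarrow> real"
    by (simp add: prod_uminus)
  \<comment> \<open>Appending the next factor and splitting off the first exposes the root 0 or s of
    \<open>V\<close>, also when l = 0 or k = 0. At such a root the derivative of \<open>V\<close> is
    the value of the cofactor.\<close>
  have low: "(\<Prod>r<k. g r) * g k = g 0 * (\<Prod>r<k. g (Suc r))"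
    and up: "(\<Prod>r<l. g r) * g l = g 0 * (\<Prod>r<l. g (Suc r))" for g :: "nat \<Rightarrow> 'a :: comm_ring_1"
    by (simp_all flip: prod.lessThan_Suc add: prod.lessThan_Suc_shift del: prod.lessThan_Suc)
  have "poly (pderiv V) 0 = - ?c"
  proof -
    define R where "R = lower_basis s k * [:- (real s - real k), 1:] *
      (\<Prod>r<l. [:real (Suc r), 1:] * [:- (real s + 1 + real r), 1:])"
    have "V = [:- 0, 1:] * R"
      using up[of "\<lambda>r. [:real r, 1:]"]
      by (simp add: V_def R_def upper_basis_def prod.distrib mult_ac del: mult_pCons_left mult_pCons_right)
    then have "poly (pderiv V) 0 = poly R 0"
      by (simp only: poly_pderiv_root)
    also have "\<dots> = (\<Prod>r<k. - (real r + 1) * - (real s - real r)) * (- (real s - real k)) *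
        (\<Prod>r<l. (real r + 1) * - (real s + 1 + real r))"
      unfolding R_def poly_mult poly_prod poly_lower_basis lin
      by (intro arg_cong2[of _ _ _ _ "(*)"] prod.cong refl) (auto simp: algebra_simps)
    also have "\<dots> = - ?c"
      by (simp only: minus_mult_minus minus_minus prod.distrib fact neg prod.lessThan_Suc mult_minus_left
        mult_minus_right mult_ac flip: lessThan_Suc_atMost)
    finally show ?thesis .
  qed
  moreover have "poly (pderiv V) (real s) = ?c"
  proof -
    define R where "R = upper_basis s l * [:real l, 1:] *
      (\<Prod>r<k. [:- (real r + 1), 1:] * [:- (real s - real (Suc r)), 1:])"
    have "V = [:- real s, 1:] * R"
      using low[of "\<lambda>r. [:- (real s - real r), 1:]"]
      by (simp add: V_def R_def lower_basis_def prod.distrib mult_ac del: mult_pCons_left mult_pCons_right)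
    then have "poly (pderiv V) (real s) = poly R (real s)"
      by (simp only: poly_pderiv_root)
    also have "\<dots> = (\<Prod>r<l. (real s + real r) * - (real r + 1)) * (real s + real l) *
        (\<Prod>r<k. (real s - real (Suc r)) * (real r + 1))"
      unfolding R_def poly_mult poly_prod poly_upper_basis lin
      by (intro arg_cong2[of _ _ _ _ "(*)"] prod.cong refl) (auto simp: algebra_simps)
    also have "\<dots> = (fact k * ((\<Prod>r<k. real s - real (Suc r)) * real s)) *
        ((- 1) ^ l * fact l * (\<Prod>r<l. real s + 1 + real r))"
    proof -
      \<comment> \<open>The factor s released here supplies the missing factor r = 0 of the product
        of the s - r.\<close>
      have shift: "(\<Prod>r<l. real s + real r) * (real s + real l) =
          real s * (\<Prod>r<l. real s + 1 + real r)"
        using up[of "\<lambda>r. real s + real r"] by (simp add: add_ac)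
      have "(\<Prod>r<l. (real s + real r) * - (real r + 1)) * (real s + real l) *
          (\<Prod>r<k. (real s - real (Suc r)) * (real r + 1)) =
        ((\<Prod>r<l. real s + real r) * (real s + real l)) * ((- 1) ^ l * fact l) *
          ((\<Prod>r<k. real s - real (Suc r)) * fact k)"
        by (simp only: prod.distrib neg fact mult_ac)
      then show ?thesis
        unfolding shift by (simp only: mult_ac)
    qed
    also have "(\<Prod>r<k. real s - real (Suc r)) * real s = (\<Prod>r\<le>k. real s - real r)"
      using low[of "\<lambda>r. real s - real r"] by (simp flip: lessThan_Suc_atMost add: mult.commute)
    finally show ?thesis .
  qed
  ultimately show ?thesis
    using main by (simp add: field_simps)
qed

section \<open>Evaluation of the Hankel determinants\<close>

text \<open>In the powers of s + 1 - y the Gram matrix is the negated Hankel matrix, of odd size,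
  while the leading coefficients contribute a square equal to 1. The determinant therefore equals
  its own negative.\<close>

lemma hankel_det_S_even: "hankel_det (2 * m) (S s) = 0"
proof -
  let ?r = "[:real s + 1, - 1:] :: real poly"
  let ?n = "Suc (2 * m)"
  have deg: "degree (?r ^ i) = i" and lead: "coeff (?r ^ i) i = (- 1) ^ i" for i
  proof -
    show "degree (?r ^ i) = i" by (simp add: degree_power_eq)
    then show "coeff (?r ^ i) i = (- 1) ^ i"
      using lead_coeff_power[of ?r i] by simp
  qed
  have "deriv_sum s (?r ^ i * ?r ^ j) = - S s (i + j)" for i j
  proof -
    have "monom 1 n \<circ>\<^sub>p ?r = ?r ^ n" for n
      by (rule poly_ext) (simp add: poly_pcompose poly_monom)
    then show ?thesis
      using deriv_sum_reflect[of s "monom 1 (i + j)"] by (simp add: deriv_sum_monom power_add)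
  qed
  moreover have "mat ?n ?n (\<lambda>(i, j). - S s (i + j)) = (- 1) \<cdot>\<^sub>m mat ?n ?n (\<lambda>(i, j). S s (i + j))"
    by (rule eq_matI) auto
  ultimately have "- hankel_det (2 * m) (S s) =
      det (mat ?n ?n (\<lambda>(i, j). deriv_sum s (?r ^ i * ?r ^ j)))"
    by (simp add: hankel_det_def)
  also have "\<dots> = (\<Prod>i\<le>2 * m. (- 1) ^ i) * (\<Prod>i\<le>2 * m. (- 1) ^ i) * hankel_det (2 * m) (S s)"
    by (subst hankel_det_change_basis[where L = "deriv_sum s"])
      (simp_all only: deriv_sum_add deriv_sum_smult deriv_sum_monom deg lead order_refl)
  also have "(\<Prod>i\<le>2 * m. (- 1) ^ i) * (\<Prod>i\<le>2 * m. (- 1) ^ i) = (1 :: real)"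
    by (simp flip: prod.distrib power_add mult_2 add: power_mult)
  finally show ?thesis by simp
qed

lemma hankel_det_S_odd_Gram:
  "hankel_det (2 * m + 1) (S s) = (- 1) ^ (m + 1) *
    (det (mat (m + 1) (m + 1)
      (\<lambda>(k, l). deriv_sum s (centre s * lower_basis s k * upper_basis s l)))) ^ 2"
proof -
  let ?g = "\<lambda>k l. deriv_sum s (centre s * lower_basis s k * upper_basis s l)"
  define p where "p i = centre s ^ (i mod 2) * lower_basis s (i div 2)" for i
  define q where "q i = centre s ^ (i mod 2) * upper_basis s (i div 2)" for i
  have nz: "centre s \<noteq> 0" "lower_basis s k \<noteq> 0" "upper_basis s k \<noteq> 0" for k
    using monic_lower_basis(2)[of s k] monic_upper_basis(2)[of s k] by (auto simp: centre_def)
  have centre: "degree (centre s) = 1" "lead_coeff (centre s) = 1"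
    by (simp_all add: centre_def)
  have deg: "degree (p i) = i" "degree (q i) = i" for i
    using nz by (simp_all add: p_def q_def degree_mult_eq degree_power_eq centre(1)
      monic_lower_basis(1) monic_upper_basis(1))
  have "lead_coeff (p i) = 1" "lead_coeff (q i) = 1" for i
    by (simp_all only: p_def q_def lead_coeff_mult lead_coeff_power centre(2)
      monic_lower_basis(2) monic_upper_basis(2) power_one mult_1)
  then have lead: "coeff (p i) i = 1" "coeff (q i) i = 1" for i
    by (simp_all add: deg)
  have Gram: "deriv_sum s (p i * q j) = (if even (i + j) then 0 else ?g (i div 2) (j div 2))" for i j
  proof (cases "even (i + j)")
    case True
    \<comment> \<open>With equal parities \<open>centre s\<close> is absent or squared, so the
      product is reflection invariant and the functional vanishes on it.\<close>
    then have "i mod 2 = j mod 2" by presburger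
    then have "(p i * q j) \<circ>\<^sub>p [:real s + 1, - 1:] = p i * q j"
      by (cases "even i") (auto simp: p_def q_def pcompose_mult reflect_lower_basis
        reflect_upper_basis reflect_centre pcompose_1 odd_iff_mod_2_eq_one)
    then have "deriv_sum s (p i * q j) = - deriv_sum s (p i * q j)"
      using deriv_sum_reflect[of s "p i * q j"] by simp
    with True show ?thesis by simp
  next
    case False
    then have "centre s ^ (i mod 2) * centre s ^ (j mod 2) = centre s"
      by (cases "even i") (auto simp: odd_iff_mod_2_eq_one)
    moreover have "p i * q j = (centre s ^ (i mod 2) * centre s ^ (j mod 2)) *
        lower_basis s (i div 2) * upper_basis s (j div 2)"
      by (simp only: p_def q_def mult_ac)
    ultimately have "p i * q j = centre s * lower_basis s (i div 2) * upper_basis s (j div 2)"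
      by simp
    with False show ?thesis by simp
  qed
  have "hankel_det (2 * m + 1) (S s) =
      det (mat (Suc (2 * m + 1)) (Suc (2 * m + 1)) (\<lambda>(i, j). deriv_sum s (p i * q j)))"
    by (subst hankel_det_change_basis[where L = "deriv_sum s"])
      (simp_all add: deriv_sum_add deriv_sum_smult deriv_sum_monom deg lead)
  also have "\<dots> = (- 1) ^ (m + 1) * (det (mat (m + 1) (m + 1) (\<lambda>(k, l). ?g k l))) ^ 2"
    using det_checkerboard[of "m + 1" ?g] by (simp add: Gram)
  finally show ?thesis .
qed

text \<open>The left side collects all that index k contributes to the Gram determinant: row factor,
  column factor and Hilbert factor. In the induction, consecutive values differ by the negated new
  factor of the product.\<close>

lemma diagonal_factor:
  "(fact k * (\<Prod>r\<le>k. real s - real r)) *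
    ((- 1) ^ k * fact k * (\<Prod>r<k. real s + 1 + real r)) *
    (fact k ^ 4 / (fact (2 * k) * fact (2 * k + 1))) =
   (- 1) ^ k * real s * (\<Prod>l = 1..k. (real l ^ 4 * (real s ^ 2 - real l ^ 2)) /
     (4 * (2 * real l + 1) * (2 * real l - 1)))"
  (is "?c k = _ * prod ?b _")
proof (induction k)
  case (Suc k)
  \<comment> \<open>Purely algebraic form of the induction step: x, y, z stand for k+1, 2k+1, 2k+3,
    F and G for k! and (2k)!, A and B for the two products, S for s and e for the sign.\<close>
  have step: "((x * F) * (A * (S - x))) * ((- e) * (x * F) * (B * (S + x))) *
      ((x * F) ^ 4 / ((2 * x * (y * G)) * (z * (2 * x * (y * G))))) =
      - (((F * A) * (e * F * B) * (F ^ 4 / (G * (y * G)))) *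
        ((x ^ 4 * (S ^ 2 - x ^ 2)) / (4 * z * y)))"
    if "x \<noteq> 0" "y \<noteq> 0" "z \<noteq> 0" "G \<noteq> 0" for x y z F G A B S e :: real
  proof -
    have sq: "S ^ 2 - x ^ 2 = (S - x) * (S + x)" and four: "4 = 2 * (2 :: real)"
      by (simp_all add: power2_eq_square algebra_simps)
    show ?thesis
      unfolding sq four times_divide_eq_right times_divide_eq_left divide_divide_eq_left minus_divide_left
      by (rule frac_eq_eq[THEN iffD2])
        (use that in simp, use that in simp, simp only: power4_eq_xxxx mult_minus_left mult_minus_right mult_ac)
  qed
  define x y z where "x = real k + 1" and "y = 2 * real k + 1" and "z = 2 * real k + 3"
  have facts: "fact (Suc k) = x * fact k" "fact (2 * k + 1) = y * fact (2 * k)"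
    "fact (2 * Suc k) = 2 * x * (y * fact (2 * k))"
    "fact (2 * Suc k + 1) = z * (2 * x * (y * fact (2 * k)))"
    by (simp_all add: x_def y_def z_def algebra_simps)
  have lin: "real (Suc k) = x" "2 * x + 1 = z" "2 * x - 1 = y"
    "real s + 1 + real k = real s + x"
    by (simp_all add: x_def y_def z_def)
  have "?c (Suc k) = - (?c k * ?b (Suc k))"
    unfolding facts lin prod.atMost_Suc prod.lessThan_Suc power_Suc[of "- 1"] mult_minus1
    by (rule step) (simp_all add: x_def y_def z_def add_nonneg_eq_0_iff)
  then show ?case
    unfolding Suc by simp
qed simp

theorem corollary3p7:
  fixes s :: nat
  assumes "s \<ge> 1"
  shows "(\<forall>m. hankel_det (2 * m) (\<lambda>k. S s k) = 0) \<and>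
    (\<forall>m. hankel_det (2 * m + 1) (\<lambda>k. S s k) =
        (- (real s ^ 2)) ^ (m + 1) *
        (\<Prod>l = 1..m. ((real l ^ 4 * (real s ^ 2 - real l ^ 2)) /
           (4 * (2 * real l + 1) * (2 * real l - 1))) ^ (2 * (m + 1 - l)))) \<and>
    (\<forall>m \<ge> s. hankel_det (2 * m + 1) (\<lambda>k. S s k) = 0)"
proof -
  define b where "b l = (real l ^ 4 * (real s ^ 2 - real l ^ 2)) /
    (4 * (2 * real l + 1) * (2 * real l - 1))" for l
  have odd: "hankel_det (2 * m + 1) (S s) =
    (- (real s ^ 2)) ^ (m + 1) * (\<Prod>l = 1..m. b l ^ (2 * (m + 1 - l)))" for m
  proof -
    have "det (mat n n (\<lambda>(k, l). deriv_sum s (centre s * lower_basis s k * upper_basis s l))) =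
        (\<Prod>k<n. (- 1) ^ k * real s * (\<Prod>l = 1..k. b l))" for n
      unfolding deriv_sum_lower_upper det_scale_rows_cols det_Hilbert b_def
      by (simp only: diagonal_factor flip: prod.distrib)
    \<comment> \<open>\<open>b l\<close> occurs in the factors k = l, ..., n, hence n + 1 - l times;
      squaring doubles this and removes the signs.\<close>
    moreover have "(\<Prod>k<Suc n. (- 1) ^ k * real s * (\<Prod>l = 1..k. b l)) ^ 2 =
        (real s ^ 2) ^ (n + 1) * (\<Prod>l = 1..n. b l ^ (2 * (n + 1 - l)))" for n
    proof (induction n)
      case (Suc n)
      \<comment> \<open>Every exponent grows by 2; the new index l = n + 1 starts from exponent
        0.\<close>
      have "(\<Prod>l = 1..Suc n. b l ^ (2 * (Suc n + 1 - l))) =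
          (\<Prod>l = 1..Suc n. b l ^ (2 * (n + 1 - l)) * b l ^ 2)"
        by (intro prod.cong refl) (auto simp flip: power_add simp: Suc_diff_le)
      also have "\<dots> = (\<Prod>l = 1..n. b l ^ (2 * (n + 1 - l))) * (\<Prod>l = 1..Suc n. b l) ^ 2"
        by (simp add: prod.distrib prod_power_distrib power_mult_distrib)
      finally have step: "(\<Prod>l = 1..Suc n. b l ^ (2 * (Suc n + 1 - l))) =
          (\<Prod>l = 1..n. b l ^ (2 * (n + 1 - l))) * (\<Prod>l = 1..Suc n. b l) ^ 2" .
      have "(\<Prod>k<Suc (Suc n). (- 1) ^ k * real s * (\<Prod>l = 1..k. b l)) ^ 2 =
          (\<Prod>k<Suc n. (- 1) ^ k * real s * (\<Prod>l = 1..k. b l)) ^ 2 *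
          (((- 1) ^ Suc n) ^ 2 * real s ^ 2 * (\<Prod>l = 1..Suc n. b l) ^ 2)"
        by (subst prod.lessThan_Suc) (simp only: power_mult_distrib)
      also have "((- 1 :: real) ^ Suc n) ^ 2 = 1"
        by (simp flip: power_mult)
      finally show ?case
        unfolding Suc step by (simp only: power_Suc mult_ac Suc_eq_plus1[symmetric] mult_1)
    qed simp
    ultimately show ?thesis
      unfolding hankel_det_S_odd_Gram by (simp only: Suc_eq_plus1 power_minus[of "real s ^ 2"] mult_ac)
  qed
  have "hankel_det (2 * m + 1) (S s) = 0" if "m \<ge> s" for m
  proof -
    \<comment> \<open>The factor l = s is in range because 1 \<le> s \<le> m, and its exponent is at
      least 2, so the zero base makes it vanish.\<close>
    have "b s ^ (2 * (m + 1 - s)) = 0"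
      using that by (simp add: b_def)
    then have "(\<Prod>l = 1..m. b l ^ (2 * (m + 1 - l))) = 0"
      using that assms by (intro prod_zero) auto
    then show ?thesis by (simp only: odd mult_zero_right)
  qed
  with odd show ?thesis
    unfolding b_def using hankel_det_S_even by blast
qed

end
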